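(* For every $\varepsilon>0$ there is a constant $C(\varepsilon)>0$ such that the following holds. Let $m$, $X$, $Y$ be positive integers, $Z$ an arbitrary integer, and ${\mathcal X} \subseteq \{x \in {\mathbb Z} : |x|\leqslant X\}$ an arbitrary set. Put ${\mathcal X}_m = \{ x\in {\mathcal X} : \gcd(x,m)=1\}$ and, for an integer $a$, $$M_{a,m}({\mathcal X};Y,Z) = \#\{ x \in {\mathcal X} : \gcd(x,m)=1,\ a x^{-1} \equiv y \pmod m \text{ for some integer } y \in [Z+1,Z+Y]\},$$ where $x^{-1}$ denotes the inverse of $x$ modulo $m$. Then $$\sum_{a=1}^m \left|M_{a,m}({\mathcal X};Y,Z) - \#{\mathcal X}_m \frac{Y}{m}\right|^2 \leqslant C(\varepsilon)\, \#{\mathcal X}\,(X+Y)\, m^{\varepsilon}.$$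
   Context: The paper writes the bound as $\#{\mathcal X}(X+Y)m^{o(1)}$; this means a factor $m^{o(1)}$ as $m\to\infty$, uniform in all other parameters, which is expressed above in the equivalent "for every $\varepsilon>0$" form.
   Formalization: The formal theorem assumes in addition that Y ≤ m; without this the claim is false, e.g. for m = 1, X = 1, 𝒳 = {1} it would say (Y−1)² ≤ C(1+Y) for all Y. *)

theory Defs
  imports Complex_Main "HOL-Number_Theory.Number_Theory"
begin

definition coprime_part :: "int set \<Rightarrow> int \<Rightarrow> int set" where
  "coprime_part A m = {x \<in> A. gcd x m = 1}"

text \<open>
  The number of \<open>x\<close> is counted, not the number of pairs \<open>(x, y)\<close>. The modulus is the first
  argument of \<^const>\<open>modular_inverse\<close>.
\<close>

definition ratio_count :: "int \<Rightarrow> int \<Rightarrow> int set \<Rightarrow> int \<Rightarrow> int \<Rightarrow> nat" where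
  "ratio_count a m A Y Z =
     card {x \<in> A. gcd x m = 1 \<and> (\<exists>y \<in> {Z + 1..Z + Y}. [a * modular_inverse m x = y] (mod m))}"

end

theory Submission
  imports Defs "HOL-Analysis.Convex" "HOL-Library.Real_Mod"
begin

text \<open>
  Expand the condition \<open>a / x mod m \<in> [Z + 1, Z + Y]\<close> in additive characters modulo \<open>m\<close>. The frequency
  \<open>h = 0\<close> gives the main term; the other frequencies \<open>h\<close>, taken with \<open>\<bar>h\<bar> \<le> m / 2\<close>, have coefficients
  of size at most \<open>min Y (2 m / \<bar>h\<bar>)\<close> and are split into \<open>O(log m)\<close> dyadic blocks \<open>\<bar>h\<bar> \<sim> H\<close>. By
  orthogonality, summing the square of one block over \<open>a\<close> counts the solutions of
  \<open>h\<^sub>1 x\<^sub>2 \<equiv> h\<^sub>2 x\<^sub>1 (mod m)\<close>. For given \<open>(h\<^sub>1, x\<^sub>2)\<close> the integer \<open>h\<^sub>2 x\<^sub>1\<close> is nonzero, lies in a fixed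
  residue class and is at most \<open>H X\<close> in size, so the divisor bound leaves \<open>(H X / m + 1) m\<^sup>o\<^sup>(\<^sup>1\<^sup>)\<close> pairs
  \<open>(h\<^sub>2, x\<^sub>1)\<close>.
\<close>

section \<open>The divisor bound\<close>

text \<open>A rescaled form of \<open>1 + t \<le> exp t\<close>, where the factor
  \<open>1 / c\<close> compensates for a small \<delta>. It serves twice: for the
  \<open>k + 1\<close> divisors of a prime power, and for the logarithmic number of dyadic
  blocks.\<close>

lemma linear_le_exponential:
  fixes \<delta> :: real
  assumes "\<delta> > 0"
  obtains K :: real where "K \<ge> 1" "\<And>k. real k + 1 \<le> K * 2 powr (\<delta> * real k)"
proof
  define c where "c = \<delta> * ln 2"
  have c: "c > 0" using assms by (simp add: c_def)
  show "max 1 (1 / c) \<ge> 1" by simp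
  fix k :: nat
  have "1 + c * real k \<le> exp (c * real k)" by (rule exp_ge_add_one_self)
  also have "exp (c * real k) = 2 powr (\<delta> * real k)"
    by (simp add: powr_def c_def mult_ac)
  finally have e: "1 + c * real k \<le> 2 powr (\<delta> * real k)" .
  have "real k + 1 \<le> max 1 (1 / c) * (1 + c * real k)"
  proof -
    have "real k = 1 / c * (c * real k)" using c by simp
    also have "\<dots> \<le> max 1 (1 / c) * (c * real k)"
      by (rule mult_right_mono) (use c in auto)
    finally show ?thesis by (simp add: distrib_left)
  qed
  also have "\<dots> \<le> max 1 (1 / c) * 2 powr (\<delta> * real k)"
    by (rule mult_left_mono[OF e]) simp
  finally show "real k + 1 \<le> max 1 (1 / c) * 2 powr (\<delta> * real k)" .
qed

text \<open>A divisor of a product splits into a divisor of each factor. Different splittings may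
  give the same divisor, hence only an inequality.\<close>

lemma card_divisors_prime_power_mult_le:
  fixes p n k :: nat
  assumes "prime p" "n > 0"
  shows "card {d. d dvd p ^ k * n} \<le> (k + 1) * card {d. d dvd n}"
proof -
  have "{d. d dvd p ^ k * n} \<subseteq> (\<lambda>(i, d). p ^ i * d) ` ({..k} \<times> {d. d dvd n})"
  proof
    fix d assume "d \<in> {d. d dvd p ^ k * n}"
    then obtain a b where ab: "d = a * b" "a dvd p ^ k" "b dvd n"
      using division_decomp[of d "p ^ k" n] by auto
    then obtain i where "i \<le> k" "a = p ^ i"
      using assms(1) divides_primepow_nat by blast
    then show "d \<in> (\<lambda>(i, d). p ^ i * d) ` ({..k} \<times> {d. d dvd n})"
      using ab by (intro image_eqI[of _ _ "(i, b)"]) auto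
  qed
  then have "card {d. d dvd p ^ k * n} \<le> card ((\<lambda>(i, d). p ^ i * d) ` ({..k} \<times> {d. d dvd n}))"
    by (intro card_mono finite_imageI) (use assms in auto)
  also have "\<dots> \<le> card ({..k} \<times> {d. d dvd n})"
    by (intro card_image_le) (use assms in auto)
  finally show ?thesis by (simp add: card_cartesian_product)
qed

text \<open>The primes of \<open>n\<close> are removed one at a time. A prime with
  \<open>p powr \<delta> \<ge> 2\<close> pays for its factor \<open>k + 1\<close> through
  \<open>k + 1 \<le> 2 ^ k\<close>; each of the finitely many smaller primes costs at most one
  factor \<open>K\<close>.\<close>

lemma divisor_bound:
  fixes \<delta> :: real
  assumes \<delta>: "\<delta> > 0"
  obtains C :: real where "C > 0" "\<And>n::nat. n > 0 \<Longrightarrow> real (card {d. d dvd n}) \<le> C * real n powr \<delta>"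
proof -
  obtain K where K: "K \<ge> 1" "\<And>k. real k + 1 \<le> K * 2 powr (\<delta> * real k)"
    using linear_le_exponential[OF \<delta>] by metis
  define S where "S = {p::nat. real p < 2 powr (1 / \<delta>)}"
  have finS: "finite S"
  proof (rule finite_subset)
    show "S \<subseteq> {..nat \<lceil>2 powr (1 / \<delta>)\<rceil>}"
      unfolding S_def by (auto simp: le_nat_iff) linarith
  qed simp
  \<comment> \<open>The exponent counts only the small primes that divide \<open>n\<close>, so that
    the induction can charge one factor \<open>K\<close> for each of them. The uniform exponent
    \<open>card S\<close> enters only at the end.\<close>
  have main: "n > 0 \<Longrightarrow> real (card {d. d dvd n}) \<le> K ^ card {p \<in> S. prime p \<and> p dvd n} * real n powr \<delta>" for n :: nat
  proof (induction n rule: less_induct)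
    case (less n)
    show ?case
    proof (cases "n = 1")
      case True
      then show ?thesis using K by simp
    next
      case False
      then obtain p where p: "prime p" "p dvd n"
        using prime_factor_nat by blast
      then have p1: "p > 1" using prime_gt_1_nat by blast
      \<comment> \<open>The full power of \<open>p\<close> is split off, so \<open>p\<close> does
        not divide the cofactor and, if small, is charged only once.\<close>
      define k where "k = multiplicity p n"
      obtain n' where n': "n = p ^ k * n'" "\<not> p dvd n'"
        using multiplicity_decompose'[of n p] less.prems p1 unfolding k_def by auto
      have "k > 0" using p n' by (cases k) auto
      have n'0: "n' > 0" using less.prems n'(1) by (cases n') auto
      have "n' < n" using n'(1) n'0 \<open>k > 0\<close> p1 using one_less_power[of p k] by simp
      have IH: "real (card {d. d dvd n'}) \<le> K ^ card {p \<in> S. prime p \<and> p dvd n'} * real n' powr \<delta>"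
        using less.IH \<open>n' < n\<close> n'0 by blast
      have pk: "real (p ^ k) powr \<delta> = real p powr (\<delta> * real k)"
        using p1 by (simp add: powr_realpow[symmetric] powr_powr mult.commute)
      have step: "(real k + 1) * K ^ card {p \<in> S. prime p \<and> p dvd n'}
          \<le> K ^ card {p \<in> S. prime p \<and> p dvd n} * real (p ^ k) powr \<delta>"
      proof (cases "p \<in> S")
        case True
        have "insert p {p \<in> S. prime p \<and> p dvd n'} \<subseteq> {p \<in> S. prime p \<and> p dvd n}"
          using True p n' by auto
        then have "card (insert p {p \<in> S. prime p \<and> p dvd n'}) \<le> card {p \<in> S. prime p \<and> p dvd n}"
          using finS by (intro card_mono) auto
        then have "Suc (card {p \<in> S. prime p \<and> p dvd n'}) \<le> card {p \<in> S. prime p \<and> p dvd n}"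
          using n'(2) finS by simp
        then have pw: "K * K ^ card {p \<in> S. prime p \<and> p dvd n'} \<le> K ^ card {p \<in> S. prime p \<and> p dvd n}"
          using power_increasing[OF _ K(1)] unfolding power_Suc[symmetric] by blast
        have "(real k + 1) \<le> K * real (p ^ k) powr \<delta>"
        proof -
          have "2 powr (\<delta> * real k) \<le> real p powr (\<delta> * real k)"
            using p1 \<delta> by (intro powr_mono2) auto
          then have "K * 2 powr (\<delta> * real k) \<le> K * real p powr (\<delta> * real k)"
            using K(1) by (intro mult_left_mono) auto
          then show ?thesis using K(2)[of k] unfolding pk by (rule order_trans[rotated])
        qed
        then have "(real k + 1) * K ^ card {p \<in> S. prime p \<and> p dvd n'}
            \<le> (K * real (p ^ k) powr \<delta>) * K ^ card {p \<in> S. prime p \<and> p dvd n'}"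
          using K(1) by (intro mult_right_mono) auto
        also have "\<dots> = (K * K ^ card {p \<in> S. prime p \<and> p dvd n'}) * real (p ^ k) powr \<delta>"
          by simp
        also have "\<dots> \<le> K ^ card {p \<in> S. prime p \<and> p dvd n} * real (p ^ k) powr \<delta>"
          using pw by (intro mult_right_mono) auto
        finally show ?thesis .
      next
        case False
        then have "2 powr (1 / \<delta>) \<le> real p" by (simp add: S_def)
        then have "(2 powr (1 / \<delta>)) powr (\<delta> * real k) \<le> real p powr (\<delta> * real k)"
          using \<delta> by (intro powr_mono2) auto
        then have "2 powr (real k) \<le> real p powr (\<delta> * real k)"
          using \<delta> by (simp add: powr_powr)
        moreover have "real k + 1 \<le> 2 ^ k"
          using Suc_leI[OF less_exp[of k]] by (metis of_nat_Suc of_nat_le_iff of_nat_numeral of_nat_power add.commute)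
        ultimately have "real k + 1 \<le> real (p ^ k) powr \<delta>"
          unfolding pk by (simp add: powr_realpow)
        moreover have "{p \<in> S. prime p \<and> p dvd n'} \<subseteq> {p \<in> S. prime p \<and> p dvd n}"
          unfolding n'(1) by auto
        then have "K ^ card {p \<in> S. prime p \<and> p dvd n'} \<le> K ^ card {p \<in> S. prime p \<and> p dvd n}"
          using finS by (intro power_increasing[OF _ K(1)] card_mono) auto
        ultimately have "K ^ card {p \<in> S. prime p \<and> p dvd n'} * (real k + 1)
            \<le> K ^ card {p \<in> S. prime p \<and> p dvd n} * real (p ^ k) powr \<delta>"
          using K(1) by (intro mult_mono) auto
        then show ?thesis by (simp add: mult.commute)
      qed
      have "real (card {d. d dvd n}) \<le> (real k + 1) * real (card {d. d dvd n'})"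
      proof -
        have "card {d. d dvd n} \<le> (k + 1) * card {d. d dvd n'}"
          using card_divisors_prime_power_mult_le[OF p(1) n'0, of k] unfolding n'(1)[symmetric] .
        then have "real (card {d. d dvd n}) \<le> real ((k + 1) * card {d. d dvd n'})"
          by (rule of_nat_mono)
        then show ?thesis by (simp only: of_nat_mult of_nat_add of_nat_1)
      qed
      also have "\<dots> \<le> (real k + 1) * (K ^ card {p \<in> S. prime p \<and> p dvd n'} * real n' powr \<delta>)"
        by (intro mult_left_mono IH) auto
      also have "\<dots> = ((real k + 1) * K ^ card {p \<in> S. prime p \<and> p dvd n'}) * real n' powr \<delta>"
        by simp
      also have "\<dots> \<le> (K ^ card {p \<in> S. prime p \<and> p dvd n} * real (p ^ k) powr \<delta>) * real n' powr \<delta>"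
        by (intro mult_right_mono step) auto
      also have "\<dots> = K ^ card {p \<in> S. prime p \<and> p dvd n} * real n powr \<delta>"
        by (subst n'(1)) (simp add: powr_mult)
      finally show ?thesis .
    qed
  qed
  show ?thesis
  proof (rule that)
    show "K ^ card S > 0" using K(1) by simp
    fix n :: nat assume "n > 0"
    have "K ^ card {p \<in> S. prime p \<and> p dvd n} \<le> K ^ card S"
      using finS K(1) by (intro power_increasing card_mono) auto
    then have "K ^ card {p \<in> S. prime p \<and> p dvd n} * real n powr \<delta> \<le> K ^ card S * real n powr \<delta>"
      by (intro mult_right_mono) auto
    then show "real (card {d. d dvd n}) \<le> K ^ card S * real n powr \<delta>"
      using main[OF \<open>n > 0\<close>] by linarith
  qed
qed

section \<open>Additive characters modulo \<open>m\<close>\<close>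

definition add_char :: "int \<Rightarrow> int \<Rightarrow> complex" where
  "add_char m k = cis (2 * pi * of_int k / of_int m)"

lemma add_char_0 [simp]: "add_char m 0 = 1"
  by (simp add: add_char_def)

lemma norm_add_char [simp]: "norm (add_char m k) = 1"
  by (simp add: add_char_def)

lemma add_char_add: "add_char m (k + l) = add_char m k * add_char m l"
  by (simp add: add_char_def cis_mult add_divide_distrib ring_distribs)

lemma cnj_add_char: "cnj (add_char m k) = add_char m (- k)"
  by (simp add: add_char_def cis_cnj)

lemma add_char_eq_1_iff:
  assumes "m > 0"
  shows "add_char m k = 1 \<longleftrightarrow> m dvd k"
proof -
  have "add_char m k = 1 \<longleftrightarrow> (\<exists>n. of_int k = (of_int (n * m) :: real))"
    using assms by (simp add: add_char_def cis_eq_1_iff field_simps)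
  also have "\<dots> \<longleftrightarrow> m dvd k"
    unfolding of_int_eq_iff by (auto simp: dvd_def mult.commute)
  finally show ?thesis .
qed

lemma add_char_cong:
  assumes "m > 0" "[k = l] (mod m)"
  shows "add_char m k = add_char m l"
proof -
  have "m dvd k - l" using assms(2) by (simp add: cong_iff_dvd_diff)
  then have "add_char m (k - l) = 1" using assms(1) by (simp add: add_char_eq_1_iff)
  then show ?thesis using add_char_add[of m "k - l" l] by simp
qed

text \<open>The geometric sum is kept free of division, so that the identity serves both complete
  sums, where the right side vanishes, and incomplete ones.\<close>

lemma add_char_telescope:
  assumes "a \<le> b"
  shows "(\<Sum>h\<in>{a..<b}. add_char m (h * k)) * (add_char m k - 1) = add_char m (b * k) - add_char m (a * k)"
  using assms
proof (induction b rule: int_ge_induct)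
  case (step b)
  have "{a..<b + 1} = insert b {a..<b}" using step.hyps by auto
  then have "(\<Sum>h\<in>{a..<b + 1}. add_char m (h * k)) * (add_char m k - 1)
      = add_char m (b * k) * (add_char m k - 1) + (\<Sum>h\<in>{a..<b}. add_char m (h * k)) * (add_char m k - 1)"
    by (simp add: distrib_right)
  also have "\<dots> = add_char m (b * k) * add_char m k - add_char m (a * k)"
    unfolding step.IH by (simp add: algebra_simps)
  also have "add_char m (b * k) * add_char m k = add_char m ((b + 1) * k)"
    by (simp add: distrib_right add_char_add)
  finally show ?case .
qed simp

text \<open>The two ends of a full period carry the same character value, so telescoping kills the
  sum unless \<open>add_char m k = 1\<close>. The start \<open>a\<close> is free because the period
  is \<open>{1..m}\<close> for the shifts but centred at 0 for the frequencies.\<close>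

lemma add_char_orthogonality:
  assumes "m > 0"
  shows "(\<Sum>h\<in>{a..<a + m}. add_char m (h * k)) = (if m dvd k then of_int m else 0)"
proof (cases "m dvd k")
  case True
  then have "add_char m (h * k) = 1" for h
    using assms by (simp add: add_char_eq_1_iff)
  then show ?thesis using assms True by simp
next
  case False
  have "add_char m ((a + m) * k) = add_char m (a * k)"
    using assms by (intro add_char_cong) (simp_all add: cong_iff_dvd_diff algebra_simps)
  then have "(\<Sum>h\<in>{a..<a + m}. add_char m (h * k)) * (add_char m k - 1) = 0"
    using add_char_telescope[of a "a + m" m k] assms by simp
  then show ?thesis using False assms by (simp add: add_char_eq_1_iff)
qed

section \<open>Bounds for incomplete character sums\<close>

lemma third_le_sin:
  fixes x :: real
  assumes "0 \<le> x" "x \<le> pi / 2"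
  shows "x / 3 \<le> sin x"
proof (cases "x = 0")
  case False
  then have x: "x > 0" using assms by simp
  have "sin x \<ge> x - x ^ 3 / 6"
  proof -
    have "(\<Sum>m<3. sin_coeff m * x ^ m) = x"
      by (simp add: sin_coeff_def numeral_3_eq_3)
    then have "\<bar>sin x - x\<bar> \<le> x ^ 3 / 6"
      using Maclaurin_sin_bound[of x 3] x by (simp add: fact_numeral)
    then show ?thesis by linarith
  qed
  \<comment> \<open>With \<open>x \<le> 2\<close> the cubic error is at most
    \<open>2 * x / 3\<close>, which leaves the third of \<open>x\<close> that is claimed.\<close>
  moreover have "x ^ 3 \<le> 4 * x"
  proof -
    have "x \<le> 2" using assms(2) pi_less_4 by simp
    then have "x * x \<le> 2 * 2" using x by (intro mult_mono) auto
    then have "x * x * x \<le> 4 * x" using x by (intro mult_right_mono) auto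
    then show ?thesis by (simp add: power3_eq_cube)
  qed
  ultimately show ?thesis by linarith
qed simp

text \<open>The chord has length \<open>2 * sin x\<close> with
  \<open>x = pi * \<bar>h\<bar> / m\<close>. The condition \<open>2 * \<bar>h\<bar> \<le> m\<close>
  keeps \<open>x\<close> in the first quadrant, where the sine has a linear lower bound.\<close>

lemma norm_add_char_minus_1_ge:
  assumes "m > 0" "2 * \<bar>h\<bar> \<le> m"
  shows "norm (add_char m h - 1) \<ge> of_int \<bar>h\<bar> / of_int m"
proof -
  define x where "x = pi * of_int \<bar>h\<bar> / of_int m"
  have x0: "x \<ge> 0" using assms by (simp add: x_def)
  have "of_int (2 * \<bar>h\<bar>) \<le> (of_int m :: real)" using assms(2) by (simp only: of_int_le_iff)
  then have "pi * (of_int (2 * \<bar>h\<bar>) :: real) \<le> pi * of_int m" by (intro mult_left_mono) auto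
  then have x1: "x \<le> pi / 2" using assms(1) by (simp add: x_def field_simps)
  define y where "y = 2 * pi * of_int h / of_int m"
  have y: "cos y = cos (2 * x)"
    by (cases "h \<ge> 0") (simp_all add: x_def y_def mult_ac)
  have "(norm (add_char m h - 1))\<^sup>2 = (cos y - 1)\<^sup>2 + (sin y)\<^sup>2"
    by (simp add: add_char_def y_def cmod_power2)
  also have "\<dots> = 2 - 2 * cos y"
    using sin_cos_squared_add[of y] by (simp add: power2_eq_square algebra_simps)
  also have "\<dots> = (2 * sin x)\<^sup>2"
    unfolding y cos_double_sin by (simp add: power2_eq_square algebra_simps)
  finally have "(norm (add_char m h - 1))\<^sup>2 = (2 * sin x)\<^sup>2" .
  then have "norm (add_char m h - 1) = 2 * sin x"
    by (rule power2_eq_imp_eq) (use third_le_sin[OF x0 x1] x0 in auto)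
  moreover have "2 * sin x \<ge> 2 * x / 3" using third_le_sin[OF x0 x1] by simp
  moreover have "2 * x / 3 \<ge> of_int \<bar>h\<bar> / of_int m"
  proof -
    have "2 * (of_int \<bar>h\<bar> / of_int m) \<le> pi * (of_int \<bar>h\<bar> / (of_int m :: real))"
      using assms(1) pi_ge_two by (intro mult_right_mono) auto
    moreover have "0 \<le> of_int \<bar>h\<bar> / (of_int m :: real)"
      using assms(1) by simp
    ultimately show ?thesis by (simp add: x_def)
  qed
  ultimately show ?thesis by linarith
qed

lemma norm_add_char_sum_le:
  assumes "m > 0" "h \<noteq> 0" "2 * \<bar>h\<bar> \<le> m" "a \<le> b"
  shows "norm (\<Sum>y\<in>{a..<b}. add_char m (y * h)) \<le> 2 * of_int m / of_int \<bar>h\<bar>"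
proof -
  let ?F = "norm (\<Sum>y\<in>{a..<b}. add_char m (y * h))"
  have "?F * (of_int \<bar>h\<bar> / of_int m) \<le> ?F * norm (add_char m h - 1)"
    by (intro mult_left_mono norm_add_char_minus_1_ge assms) auto
  also have "\<dots> = norm (add_char m (b * h) - add_char m (a * h))"
    unfolding add_char_telescope[OF assms(4), symmetric] norm_mult ..
  also have "\<dots> \<le> 2" using norm_triangle_ineq4[of "add_char m (b * h)" "add_char m (a * h)"] by simp
  finally show ?thesis using assms(1,2) by (simp add: field_simps)
qed

text \<open>Opening the square and summing over \<open>a\<close> leaves, by orthogonality, only the
  pairs with \<open>t p\<close> and \<open>t q\<close> congruent; each contributes
  \<open>m * c p * cnj (c q)\<close>, of size at most \<open>m * W\<^sup>2\<close>.\<close>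

lemma sum_norm_add_char_sum_le:
  fixes c :: "'a \<Rightarrow> complex" and t :: "'a \<Rightarrow> int"
  assumes m: "m > 0" and P: "finite P" and W: "\<And>p. p \<in> P \<Longrightarrow> norm (c p) \<le> W"
  shows "(\<Sum>a = 1..m. (norm (\<Sum>p\<in>P. c p * add_char m (a * t p)))\<^sup>2)
    \<le> of_int m * W\<^sup>2 * real (card {(p, q). p \<in> P \<and> q \<in> P \<and> [t p = t q] (mod m)})"
proof -
  let ?S = "\<lambda>a. \<Sum>p\<in>P. c p * add_char m (a * t p)"
  let ?E = "{(p, q). p \<in> P \<and> q \<in> P \<and> [t p = t q] (mod m)}"
  have sub: "?E \<subseteq> P \<times> P" by auto
  have orth: "(\<Sum>a = 1..m. add_char m (a * k)) = (if m dvd k then of_int m else 0)" for k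
  proof -
    have "{1..m} = {1..<1 + m}" by auto
    then show ?thesis using add_char_orthogonality[OF m, where a = 1 and k = k] by simp
  qed
  have "complex_of_real ((norm (?S a))\<^sup>2)
      = (\<Sum>(p, q)\<in>P \<times> P. c p * cnj (c q) * add_char m (a * (t p - t q)))" for a
  proof -
    have "complex_of_real ((norm (?S a))\<^sup>2) = ?S a * cnj (?S a)"
      by (rule complex_norm_square)
    also have "\<dots> = (\<Sum>p\<in>P. \<Sum>q\<in>P. c p * add_char m (a * t p) * (cnj (c q) * add_char m (- (a * t q))))"
      by (simp add: cnj_sum sum_product cnj_add_char)
    also have "\<dots> = (\<Sum>p\<in>P. \<Sum>q\<in>P. c p * cnj (c q) * add_char m (a * (t p - t q)))"
    proof (intro sum.cong refl)
      fix p q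
      have "a * (t p - t q) = a * t p + - (a * t q)" by (simp add: algebra_simps)
      then show "c p * add_char m (a * t p) * (cnj (c q) * add_char m (- (a * t q)))
          = c p * cnj (c q) * add_char m (a * (t p - t q))"
        by (simp only: add_char_add mult_ac)
    qed
    finally show ?thesis by (simp add: sum.cartesian_product)
  qed
  then have "complex_of_real (\<Sum>a = 1..m. (norm (?S a))\<^sup>2)
      = (\<Sum>a = 1..m. \<Sum>(p, q)\<in>P \<times> P. c p * cnj (c q) * add_char m (a * (t p - t q)))"
    by simp
  also have "\<dots> = (\<Sum>(p, q)\<in>P \<times> P. c p * cnj (c q) * (\<Sum>a = 1..m. add_char m (a * (t p - t q))))"
    by (subst sum.swap) (simp add: sum_distrib_left split_def)
  also have "\<dots> = (\<Sum>(p, q)\<in>?E. c p * cnj (c q) * of_int m)"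
  proof (rule sum.mono_neutral_cong_right)
    show "\<forall>x\<in>P \<times> P - ?E. (case x of (p, q) \<Rightarrow> c p * cnj (c q) * (\<Sum>a = 1..m. add_char m (a * (t p - t q)))) = 0"
      unfolding orth by (auto simp: cong_iff_dvd_diff split: if_splits)
    show "(case x of (p, q) \<Rightarrow> c p * cnj (c q) * (\<Sum>a = 1..m. add_char m (a * (t p - t q))))
        = (case x of (p, q) \<Rightarrow> c p * cnj (c q) * of_int m)" if "x \<in> ?E" for x
      using that unfolding orth by (auto simp: cong_iff_dvd_diff)
  qed (use P sub in auto)
  finally have eq: "complex_of_real (\<Sum>a = 1..m. (norm (?S a))\<^sup>2) = (\<Sum>(p, q)\<in>?E. c p * cnj (c q) * of_int m)" .
  \<comment> \<open>The sum is a nonnegative real, so it equals its complex norm and the triangle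
    inequality applies to the expansion.\<close>
  have "(\<Sum>a = 1..m. (norm (?S a))\<^sup>2) = norm (complex_of_real (\<Sum>a = 1..m. (norm (?S a))\<^sup>2))"
    unfolding norm_of_real by (simp add: sum_nonneg)
  also have "\<dots> \<le> (\<Sum>x\<in>?E. W * W * of_int m)"
    unfolding eq
  proof (rule sum_norm_le)
    fix x assume "x \<in> ?E"
    then obtain p q where x: "x = (p, q)" and pq: "p \<in> P" "q \<in> P" by auto
    have "W \<ge> 0" using W[OF pq(1)] norm_ge_zero order_trans by blast
    then have "norm (c p) * norm (c q) \<le> W * W"
      using W pq by (intro mult_mono) auto
    then show "norm (case x of (p, q) \<Rightarrow> c p * cnj (c q) * of_int m) \<le> W * W * of_int m"
      using m by (simp add: x norm_mult)
  qed
  finally show ?thesis by (simp add: power2_eq_square mult_ac)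
qed

section \<open>Counting solutions of congruences\<close>

text \<open>Members of one residue class differ by multiples of \<open>m\<close>, so the quotient
  \<open>(z - a) div m\<close> separates them.\<close>

lemma card_cong_interval_le:
  fixes a b r m :: int
  assumes m: "m > 0" and ab: "a \<le> b"
  shows "real (card {z \<in> {a..b}. [z = r] (mod m)}) \<le> of_int (b - a) / of_int m + 1"
proof -
  let ?S = "{z \<in> {a..b}. [z = r] (mod m)}"
  have inj: "inj_on (\<lambda>z. (z - a) div m) ?S"
  proof (rule inj_onI)
    fix z w assume zw: "z \<in> ?S" "w \<in> ?S" and eq: "(z - a) div m = (w - a) div m"
    have "[z = r] (mod m)" "[w = r] (mod m)" using zw by auto
    then have "[z = w] (mod m)" by (rule cong_trans[OF _ cong_sym])
    then have "[z - a = w - a] (mod m)" by (intro cong_diff cong_refl)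
    then have eq': "(z - a) mod m = (w - a) mod m" by (simp only: cong_def)
    have "z - a = (z - a) div m * m + (z - a) mod m" by (rule div_mult_mod_eq[symmetric])
    also have "\<dots> = (w - a) div m * m + (w - a) mod m" by (simp only: eq eq')
    also have "\<dots> = w - a" by (rule div_mult_mod_eq)
    finally show "z = w" by simp
  qed
  have "(\<lambda>z. (z - a) div m) ` ?S \<subseteq> {0..(b - a) div m}"
    using m by (auto simp: pos_imp_zdiv_nonneg_iff intro!: zdiv_mono1)
  then have "card ?S \<le> card {0..(b - a) div m}"
    unfolding card_image[OF inj, symmetric] by (intro card_mono) auto
  moreover have "real (card {0..(b - a) div m}) = of_int ((b - a) div m) + 1"
    using m ab by (simp add: pos_imp_zdiv_nonneg_iff)
  moreover have "of_int ((b - a) div m) \<le> of_int (b - a) / (of_int m :: real)"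
    by (rule real_of_int_div4)
  ultimately show ?thesis by linarith
qed

lemma finite_int_divisors:
  fixes z :: int
  assumes "z \<noteq> 0"
  shows "finite {h. h dvd z}"
proof (rule finite_subset)
  show "{h. h dvd z} \<subseteq> {-\<bar>z\<bar>..\<bar>z\<bar>}"
    using assms dvd_imp_le_int by force
qed simp

lemma card_int_divisors_le:
  fixes z :: int
  assumes "z \<noteq> 0"
  shows "card {h. h dvd z} \<le> 2 * card {d::nat. d dvd nat \<bar>z\<bar>}"
proof -
  let ?D = "{d::nat. d dvd nat \<bar>z\<bar>}"
  have fin: "finite ?D" using assms by (intro finite_divisors_nat) simp
  have "{h. h dvd z} \<subseteq> int ` ?D \<union> (\<lambda>d. - int d) ` ?D"
  proof
    fix h assume "h \<in> {h. h dvd z}"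
    then have "nat \<bar>h\<bar> \<in> ?D"
      by (simp add: nat_dvd_iff)
    moreover have "h = int (nat \<bar>h\<bar>) \<or> h = - int (nat \<bar>h\<bar>)" by auto
    ultimately show "h \<in> int ` ?D \<union> (\<lambda>d. - int d) ` ?D" by blast
  qed
  then have "card {h. h dvd z} \<le> card (int ` ?D \<union> (\<lambda>d. - int d) ` ?D)"
    using fin by (intro card_mono) auto
  also have "\<dots> \<le> card (int ` ?D) + card ((\<lambda>d. - int d) ` ?D)" by (rule card_Un_le)
  also have "\<dots> \<le> card ?D + card ?D"
    using fin by (intro add_mono card_image_le)
  finally show ?thesis by simp
qed

text \<open>The common pattern of the counts below: choose a parameter \<open>i\<close>, then one of
  at most \<open>D\<close> completions; these choices reach all of \<open>S\<close>.\<close>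

lemma card_Sigma_image_le:
  fixes D :: real
  assumes "finite I" "\<And>i. i \<in> I \<Longrightarrow> finite (B i)" "\<And>i. i \<in> I \<Longrightarrow> real (card (B i)) \<le> D"
    and "S \<subseteq> f ` Sigma I B"
  shows "real (card S) \<le> real (card I) * D"
proof -
  have "card S \<le> card (f ` Sigma I B)"
    using assms by (intro card_mono) auto
  also have "\<dots> \<le> card (Sigma I B)"
    using assms by (intro card_image_le) auto
  also have "\<dots> = (\<Sum>i\<in>I. card (B i))"
    using assms by simp
  finally have "real (card S) \<le> (\<Sum>i\<in>I. real (card (B i)))"
    unfolding of_nat_sum[symmetric] by (rule of_nat_mono)
  also have "\<dots> \<le> real (card I) * D"
    using assms(3) by (intro sum_bounded_above) auto
  finally show ?thesis .
qed

text \<open>The product \<open>z = h * x\<close> lies in a fixed residue class and in an interval of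
  length \<open>2 * H * X\<close>; once \<open>z\<close> is known, the divisor \<open>h\<close>
  determines \<open>x\<close>. The factor 2 before \<open>D\<close> accounts for the sign of
  \<open>h\<close>.\<close>

lemma card_mult_cong_le:
  fixes m H X r :: int and D :: real
  assumes m: "m > 0" and H: "H > 0" and X: "X > 0"
    and D: "\<And>n::nat. n > 0 \<Longrightarrow> int n \<le> H * X \<Longrightarrow> real (card {d. d dvd n}) \<le> D"
  shows "real (card {(h, x). h \<noteq> 0 \<and> \<bar>h\<bar> \<le> H \<and> x \<noteq> 0 \<and> \<bar>x\<bar> \<le> X \<and> [h * x = r] (mod m)})
    \<le> (2 * of_int H * of_int X / of_int m + 1) * (2 * D)"
proof -
  have HX: "H * X > 0" using H X by simp
  have D0: "D \<ge> 0" using D[of 1] HX by force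
  let ?S = "{(h, x). h \<noteq> 0 \<and> \<bar>h\<bar> \<le> H \<and> x \<noteq> 0 \<and> \<bar>x\<bar> \<le> X \<and> [h * x = r] (mod m)}"
  let ?N = "{z \<in> {-(H * X)..H * X}. [z = r] (mod m)}"
  \<comment> \<open>Zero has infinitely many divisors; it never occurs as a product because
    \<open>h\<close> and \<open>x\<close> are nonzero.\<close>
  let ?I = "?N - {0}"
  have fin: "finite ?N" by (rule finite_subset[of _ "{-(H * X)..H * X}"]) auto
  have "?S \<subseteq> (\<lambda>(z, h). (h, z div h)) ` Sigma ?I (\<lambda>z. {h. h dvd z})"
  proof
    fix p assume "p \<in> ?S"
    then obtain h x where p: "p = (h, x)" "h \<noteq> 0" "x \<noteq> 0" "\<bar>h\<bar> \<le> H" "\<bar>x\<bar> \<le> X" "[h * x = r] (mod m)"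
      by auto
    have "\<bar>h * x\<bar> \<le> H * X" unfolding abs_mult using p(4,5) H by (intro mult_mono) auto
    then have "h * x \<in> ?I" using p by auto
    then show "p \<in> (\<lambda>(z, h). (h, z div h)) ` Sigma ?I (\<lambda>z. {h. h dvd z})"
      using p by (intro image_eqI[of _ _ "(h * x, h)"]) auto
  qed
  then have "real (card ?S) \<le> real (card ?I) * (2 * D)"
  proof (rule card_Sigma_image_le[rotated 3])
    show "finite ?I" using fin by (rule finite_Diff)
    fix z assume z: "z \<in> ?I"
    then show "finite {h. h dvd z}" by (intro finite_int_divisors) auto
    have "real (card {h. h dvd z}) \<le> real (2 * card {d::nat. d dvd nat \<bar>z\<bar>})"
      using z card_int_divisors_le[of z] by (intro of_nat_mono) auto
    moreover have "real (card {d::nat. d dvd nat \<bar>z\<bar>}) \<le> D"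
      using z by (intro D) auto
    ultimately show "real (card {h. h dvd z}) \<le> 2 * D" by simp
  qed
  also have "\<dots> \<le> (2 * of_int H * of_int X / of_int m + 1) * (2 * D)"
  proof (rule mult_right_mono)
    have "card ?I \<le> card ?N" by (rule card_mono[OF fin]) auto
    then have "real (card ?I) \<le> real (card ?N)" by (rule of_nat_mono)
    also have "\<dots> \<le> of_int (H * X - (-(H * X))) / of_int m + 1"
      using HX by (intro card_cong_interval_le[OF m]) simp
    finally show "real (card ?I) \<le> 2 * of_int H * of_int X / of_int m + 1" by simp
  qed (use D0 in simp)
  finally show ?thesis .
qed

text \<open>For \<open>X \<le> m\<close> the products are at most \<open>m * m\<close>, so the
  divisor bound is taken with exponent \<open>\<delta> / 2\<close>. For \<open>m > 1\<close>
  coprimality forces \<open>x \<noteq> 0\<close> and survives reduction modulo \<open>m\<close>,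
  which brings larger \<open>X\<close> back to \<open>X = m\<close>.\<close>

lemma card_mult_cong_coprime_le:
  fixes \<delta> :: real
  assumes \<delta>: "\<delta> > 0"
  obtains C :: real where "C > 0"
    "\<And>m H X r :: int. m > 1 \<Longrightarrow> H \<ge> 1 \<Longrightarrow> H \<le> m \<Longrightarrow> X > 0 \<Longrightarrow>
      real (card {(h, x). h \<noteq> 0 \<and> \<bar>h\<bar> \<le> H \<and> coprime x m \<and> \<bar>x\<bar> \<le> X \<and> [h * x = r] (mod m)})
      \<le> C * of_int m powr \<delta> * (of_int H * of_int X / of_int m + 1)"
proof -
  have "\<delta> / 2 > 0" using \<delta> by simp
  then obtain C where C: "C > 0" "\<And>n::nat. n > 0 \<Longrightarrow> real (card {d. d dvd n}) \<le> C * real n powr (\<delta> / 2)"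
    using divisor_bound[of "\<delta> / 2"] by metis
  have small: "real (card {(h, x). h \<noteq> 0 \<and> \<bar>h\<bar> \<le> H \<and> x \<noteq> 0 \<and> \<bar>x\<bar> \<le> X \<and> [h * x = r] (mod m)})
      \<le> (2 * of_int H * of_int X / of_int m + 1) * (2 * (C * of_int m powr \<delta>))"
    if "m > 1" "H \<ge> 1" "H \<le> m" "X > 0" "X \<le> m" for m H X r :: int
  proof (rule card_mult_cong_le)
    fix n :: nat assume n: "n > 0" "int n \<le> H * X"
    have "H * X \<le> m * m" using that by (intro mult_mono) auto
    then have "int n \<le> m * m" using n by simp
    then have "of_int (int n) \<le> (of_int (m * m) :: real)" by (simp only: of_int_le_iff)
    then have "real n \<le> of_int m * of_int m" by simp
    then have "real n powr (\<delta> / 2) \<le> (of_int m * of_int m) powr (\<delta> / 2)"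
      using \<delta> by (intro powr_mono2) auto
    also have "\<dots> = of_int m powr \<delta>"
      using that by (simp add: powr_mult powr_add[symmetric])
    finally have "C * real n powr (\<delta> / 2) \<le> C * of_int m powr \<delta>"
      using C(1) by (intro mult_left_mono) auto
    then show "real (card {d. d dvd n}) \<le> C * of_int m powr \<delta>"
      using C(2)[OF n(1)] by linarith
  qed (use that in auto)
  show ?thesis
  proof (rule that)
    \<comment> \<open>The constant is 3 * 2 * 3, from the case \<open>X > m\<close>:
      \<open>2 * H + 1 \<le> 3 * H\<close>, the factor 2 for signs, and at most
      \<open>3 * X / m\<close> lifts of each residue. The case \<open>X \<le> m\<close> needs
      less.\<close>
    show "18 * C > 0" using C by simp
    fix m H X r :: int assume m: "m > 1" and H: "H \<ge> 1" "H \<le> m" and X: "X > 0"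
    define q where "q = of_int H * of_int X / (of_int m :: real)"
    define M where "M = C * of_int m powr \<delta>"
    have q: "q \<ge> 0" using m H X by (simp add: q_def)
    have M: "M \<ge> 0" using C by (simp add: M_def)
    let ?S = "{(h, x). h \<noteq> 0 \<and> \<bar>h\<bar> \<le> H \<and> coprime x m \<and> \<bar>x\<bar> \<le> X \<and> [h * x = r] (mod m)}"
    let ?T = "\<lambda>X. {(h, x). h \<noteq> 0 \<and> \<bar>h\<bar> \<le> H \<and> x \<noteq> 0 \<and> \<bar>x\<bar> \<le> X \<and> [h * x = r] (mod m)}"
    have finT: "finite (?T X)" for X
      by (rule finite_subset[of _ "{-H..H} \<times> {-X..X}"]) auto
    have nz: "x \<noteq> 0" if "coprime x m" for x using that m by auto
    have "real (card ?S) \<le> 18 * M * (q + 1)"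
    proof (cases "X \<le> m")
      case True
      have "real (card ?S) \<le> real (card (?T X))"
        using finT nz by (intro of_nat_mono card_mono) auto
      also have "\<dots> \<le> (2 * q + 1) * (2 * M)"
        using small[OF m H X True, of r] by (simp add: q_def M_def mult.assoc)
      also have "\<dots> \<le> 18 * M * (q + 1)"
        using mult_nonneg_nonneg[OF M q] M by (simp add: algebra_simps)
      finally show ?thesis .
    next
      case False
      \<comment> \<open>Reducing \<open>x\<close> modulo \<open>m\<close> keeps the products below \<open>m\<^sup>2\<close>, so that the divisor bound costs a
        power of \<open>m\<close> and not of \<open>X\<close>.\<close>
      have "?S \<subseteq> (\<lambda>((h, s), x). (h, x)) ` Sigma (?T m) (\<lambda>(h, s). {x \<in> {-X..X}. [x = s] (mod m)})"
      proof
        fix p assume "p \<in> ?S"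
        then obtain h x where p: "p = (h, x)" "h \<noteq> 0" "\<bar>h\<bar> \<le> H" "coprime x m" "\<bar>x\<bar> \<le> X" "[h * x = r] (mod m)"
          by auto
        have c: "[x mod m = x] (mod m)" by (simp add: cong_def)
        have "coprime (x mod m) m" using p(4) m by (simp add: coprime_mod_left_iff)
        then have "x mod m \<noteq> 0" by (rule nz)
        moreover have "\<bar>x mod m\<bar> \<le> m" using m by (simp add: less_imp_le)
        moreover have "[h * (x mod m) = r] (mod m)"
          using p(6) c by (meson cong_scalar_left cong_trans)
        ultimately have "(h, x mod m) \<in> ?T m" using p by simp
        then show "p \<in> (\<lambda>((h, s), x). (h, x)) ` Sigma (?T m) (\<lambda>(h, s). {x \<in> {-X..X}. [x = s] (mod m)})"
          using p c by (intro image_eqI[of _ _ "((h, x mod m), x)"]) (auto intro: cong_sym)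
      qed
      then have "real (card ?S) \<le> real (card (?T m)) * (3 * (of_int X / of_int m))"
      proof (rule card_Sigma_image_le[rotated 3])
        show "finite (?T m)" by (rule finT)
        fix i :: "int \<times> int"
        obtain h s where i: "i = (h, s)" by (cases i)
        show "finite (case i of (h, s) \<Rightarrow> {x \<in> {-X..X}. [x = s] (mod m)})"
          unfolding i prod.case by (rule finite_subset[of _ "{-X..X}"]) auto
        have "real (card {x \<in> {-X..X}. [x = s] (mod m)}) \<le> of_int (X - (-X)) / of_int m + 1"
          using m X by (intro card_cong_interval_le) auto
        also have "\<dots> \<le> 3 * (of_int X / of_int m)"
          using m False by (simp add: field_simps)
        finally show "real (card (case i of (h, s) \<Rightarrow> {x \<in> {-X..X}. [x = s] (mod m)})) \<le> 3 * (of_int X / of_int m)"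
          by (simp add: i)
      qed
      also have "\<dots> \<le> ((2 * of_int H + 1) * (2 * M)) * (3 * (of_int X / of_int m))"
        using small[of m H m r] m H X by (intro mult_right_mono) (auto simp: M_def)
      also have "\<dots> \<le> ((3 * of_int H) * (2 * M)) * (3 * (of_int X / of_int m))"
        using m H X M by (intro mult_right_mono) auto
      also have "\<dots> = 18 * M * q" by (simp add: q_def)
      also have "\<dots> \<le> 18 * M * (q + 1)" using M q by (intro mult_left_mono) auto
      finally show ?thesis .
    qed
    then show "real (card ?S) \<le> 18 * C * of_int m powr \<delta> * (of_int H * of_int X / of_int m + 1)"
      by (simp add: M_def q_def mult.assoc)
  qed
qed

section \<open>Fourier expansion of the counting function\<close>

text \<open>Multiplying \<open>g / x = h / w\<close> by \<open>x * w\<close> turns it into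
  \<open>h * x = g * w\<close> modulo \<open>m\<close>. Fixing the mixed pair \<open>(g, w)\<close>
  fixes the residue, and at most \<open>K\<close> pairs \<open>(h, x)\<close> remain.\<close>

lemma card_cross_ratio_cong_le:
  fixes A B :: "int set" and K :: real
  assumes fin: "finite A" "finite B"
    and cop: "\<And>x. x \<in> A \<Longrightarrow> coprime x m"
    and K: "\<And>r. real (card {(h, x). h \<in> B \<and> x \<in> A \<and> [h * x = r] (mod m)}) \<le> K"
  shows "real (card {(p, q). p \<in> B \<times> A \<and> q \<in> B \<times> A \<and>
      [fst p * modular_inverse m (snd p) = fst q * modular_inverse m (snd q)] (mod m)})
    \<le> real (card B) * real (card A) * K"
proof -
  let ?F = "\<lambda>(g, w). {(h, x). h \<in> B \<and> x \<in> A \<and> [h * x = g * w] (mod m)}"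
  let ?E = "{(p, q). p \<in> B \<times> A \<and> q \<in> B \<times> A \<and>
      [fst p * modular_inverse m (snd p) = fst q * modular_inverse m (snd q)] (mod m)}"
  have "?E \<subseteq> (\<lambda>((g, w), (h, x)). ((g, x), (h, w))) ` Sigma (B \<times> A) ?F"
  proof
    fix e assume "e \<in> ?E"
    then obtain g x h w where e: "e = ((g, x), (h, w))" and mem: "g \<in> B" "h \<in> B" "x \<in> A" "w \<in> A"
      and cong: "[g * modular_inverse m x = h * modular_inverse m w] (mod m)"
      by auto
    have "[h * x * (modular_inverse m w * w) = h * x * 1] (mod m)"
      by (intro cong_mult cong_refl cong_modular_inverse2 cop mem)
    then have "[h * x = h * modular_inverse m w * (x * w)] (mod m)"
      by (simp add: cong_sym mult_ac)
    also have "[h * modular_inverse m w * (x * w) = g * modular_inverse m x * (x * w)] (mod m)"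
      by (intro cong_mult cong_refl cong_sym[OF cong])
    also have "[g * modular_inverse m x * (x * w) = g * w] (mod m)"
    proof -
      have "[g * w * (modular_inverse m x * x) = g * w * 1] (mod m)"
        by (intro cong_mult cong_refl cong_modular_inverse2 cop mem)
      then show ?thesis by (simp add: mult_ac)
    qed
    finally have "[h * x = g * w] (mod m)" .
    then show "e \<in> (\<lambda>((g, w), (h, x)). ((g, x), (h, w))) ` Sigma (B \<times> A) ?F"
      using e mem by (intro image_eqI[of _ _ "((g, w), (h, x))"]) auto
  qed
  then have "real (card ?E) \<le> real (card (B \<times> A)) * K"
  proof (rule card_Sigma_image_le[rotated 3])
    show "finite (B \<times> A)" using fin by simp
    fix i :: "int \<times> int"
    show "finite (?F i)"
      by (cases i, rule finite_subset[of _ "B \<times> A"]) (use fin in auto)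
    show "real (card (?F i)) \<le> K"
      using K by (cases i) simp
  qed
  then show ?thesis by (simp add: card_cartesian_product)
qed

lemma of_real_of_bool: "of_real (of_bool P) = of_bool P"
  by (cases P) simp_all

text \<open>The Fourier coefficient of the indicator of \<open>[Z + 1, Z + Y]\<close> modulo
  \<open>m\<close>, with the normalisation \<open>1 / m\<close> left out. The half-open range
  matches the telescoping identity.\<close>

definition interval_coeff :: "int \<Rightarrow> int \<Rightarrow> int \<Rightarrow> int \<Rightarrow> complex" where
  "interval_coeff m Y Z h = (\<Sum>y\<in>{Z + 1..<Z + 1 + Y}. add_char m (y * (- h)))"

lemma interval_coeff_0: "Y > 0 \<Longrightarrow> interval_coeff m Y Z 0 = of_int Y"
  by (simp add: interval_coeff_def)

lemma norm_interval_coeff_le: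
  assumes "Y > 0"
  shows "norm (interval_coeff m Y Z h) \<le> of_int Y"
proof -
  have "norm (interval_coeff m Y Z h) \<le> (\<Sum>y\<in>{Z + 1..<Z + 1 + Y}. 1)"
    unfolding interval_coeff_def by (intro sum_norm_le) simp
  then show ?thesis using assms by simp
qed

text \<open>By orthogonality the right side counts the \<open>y\<close> in the interval congruent to
  \<open>t\<close>. Since \<open>Y \<le> m\<close> there is at most one, so the count is the
  indicator.\<close>

lemma interval_indicator_eq:
  assumes m: "m > 0" and Y: "Y > 0" "Y \<le> m"
  shows "(of_bool (\<exists>y\<in>{Z + 1..Z + Y}. [t = y] (mod m)) :: complex)
    = (\<Sum>h\<in>{s..<s + m}. interval_coeff m Y Z h * add_char m (h * t)) / of_int m"
proof -
  let ?I = "{Z + 1..<Z + 1 + Y}"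
  let ?J = "{y \<in> ?I. m dvd t - y}"
  have "(\<Sum>h\<in>{s..<s + m}. interval_coeff m Y Z h * add_char m (h * t))
      = (\<Sum>h\<in>{s..<s + m}. \<Sum>y\<in>?I. add_char m (h * (t - y)))"
  proof (rule sum.cong[OF refl])
    fix h
    have "add_char m (y * (- h)) * add_char m (h * t) = add_char m (h * (t - y))" for y
      unfolding add_char_add[symmetric] by (simp add: algebra_simps)
    then show "interval_coeff m Y Z h * add_char m (h * t) = (\<Sum>y\<in>?I. add_char m (h * (t - y)))"
      unfolding interval_coeff_def sum_distrib_right by simp
  qed
  also have "\<dots> = (\<Sum>y\<in>?I. if m dvd t - y then of_int m else 0)"
    by (subst sum.swap) (simp only: add_char_orthogonality[OF m])
  also have "\<dots> = of_int m * of_nat (card ?J)"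
    by (subst sum.inter_filter[symmetric]) simp_all
  finally have sum_eq: "(\<Sum>h\<in>{s..<s + m}. interval_coeff m Y Z h * add_char m (h * t)) = of_int m * of_nat (card ?J)" .
  have uniq: "y = y'" if "y \<in> ?J" "y' \<in> ?J" for y y'
  proof -
    have "m dvd t - y" "m dvd t - y'" using that by auto
    then have "m dvd (t - y) - (t - y')" by (rule dvd_diff)
    then have "m dvd y' - y" by simp
    moreover have "\<bar>y' - y\<bar> < m" using that Y by auto
    ultimately show ?thesis using zdvd_not_zless[of "\<bar>y' - y\<bar>" m] by fastforce
  qed
  have "card ?J = of_bool (\<exists>y\<in>{Z + 1..Z + Y}. [t = y] (mod m))"
  proof (cases "\<exists>y\<in>{Z + 1..Z + Y}. [t = y] (mod m)")
    case True
    then obtain y where "y \<in> {Z + 1..Z + Y}" "m dvd t - y" by (auto simp: cong_iff_dvd_diff)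
    then have "y \<in> ?J" by simp
    then have "?J = {y}" using uniq by blast
    then have "card ?J = 1" by (simp only: card.insert card.empty finite.emptyI) simp
    then show ?thesis using True by simp
  next
    case False
    then have "?J = {}" by (auto simp: cong_iff_dvd_diff)
    then have "card ?J = 0" by (simp only: card.empty)
    then show ?thesis using False by simp
  qed
  then show ?thesis unfolding sum_eq using m by simp
qed

text \<open>The frequency 0 produces exactly the subtracted main term. The period is centred at 0 so
  that the remaining frequencies satisfy \<open>2 * \<bar>h\<bar> \<le> m\<close>.\<close>

lemma ratio_count_fourier:
  assumes m: "m > 0" and Y: "Y > 0" "Y \<le> m" and A: "finite A"
  shows "complex_of_real (real (ratio_count a m A Y Z) - real (card (coprime_part A m)) * (of_int Y / of_int m))
    = (\<Sum>h\<in>{-(m div 2)..<-(m div 2) + m} - {0}. \<Sum>x\<in>coprime_part A m.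
        interval_coeff m Y Z h * add_char m (a * (h * modular_inverse m x))) / of_int m"
proof -
  let ?R = "{-(m div 2)..<-(m div 2) + m}"
  let ?A = "coprime_part A m"
  let ?f = "\<lambda>h x. interval_coeff m Y Z h * add_char m (a * (h * modular_inverse m x))"
  have finA: "finite ?A" using A by (simp add: coprime_part_def)
  have "0 \<in> ?R" using m by auto
  have "ratio_count a m A Y Z = card {x \<in> ?A. \<exists>y\<in>{Z + 1..Z + Y}. [a * modular_inverse m x = y] (mod m)}"
    unfolding ratio_count_def coprime_part_def by (intro arg_cong[of _ _ card]) auto
  also have "\<dots> = (\<Sum>x\<in>?A. of_bool (\<exists>y\<in>{Z + 1..Z + Y}. [a * modular_inverse m x = y] (mod m)))"
    using finA by (simp add: of_bool_def sum.inter_filter[symmetric])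
  finally have "complex_of_real (real (ratio_count a m A Y Z))
      = (\<Sum>x\<in>?A. of_bool (\<exists>y\<in>{Z + 1..Z + Y}. [a * modular_inverse m x = y] (mod m)))"
    by (simp only: of_nat_sum of_nat_of_bool of_real_sum of_real_of_bool)
  also have "\<dots> = (\<Sum>x\<in>?A. (\<Sum>h\<in>?R. ?f h x) / of_int m)"
    by (intro sum.cong refl, subst interval_indicator_eq[OF m Y, where s = "-(m div 2)"]) (simp add: mult.left_commute)
  also have "\<dots> = (\<Sum>h\<in>?R. \<Sum>x\<in>?A. ?f h x) / of_int m"
    unfolding sum_divide_distrib[symmetric] by (subst sum.swap) simp
  also have "(\<Sum>h\<in>?R. \<Sum>x\<in>?A. ?f h x) = (\<Sum>x\<in>?A. ?f 0 x) + (\<Sum>h\<in>?R - {0}. \<Sum>x\<in>?A. ?f h x)"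
    by (rule sum.remove) (use \<open>0 \<in> ?R\<close> in auto)
  also have "(\<Sum>x\<in>?A. ?f 0 x) = of_nat (card ?A) * of_int Y"
    using Y by (simp add: interval_coeff_0)
  finally show ?thesis by (simp add: add_divide_distrib)
qed

lemma dyadic_exponent:
  fixes M :: nat
  assumes "M > 0"
  obtains L where "2 ^ L \<le> M" "M < 2 ^ Suc L"
  using ex_power_ivl1[of 2 M] assms by auto

section \<open>The second moment\<close>

text \<open>Orthogonality and cross multiplication give
  \<open>m * W\<^sup>2 * card B * card A * Q * (H * X / m + 1)\<close>, where
  \<open>card B \<le> 2 * H\<close> and \<open>W\<close> bounds the coefficients. The choice of
  \<open>W\<close> makes the outcome independent of \<open>H\<close>.\<close>

lemma dyadic_block_second_moment:
  fixes A B :: "int set" and m H X Y Z :: int and Q :: real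
  assumes m: "m > 0" and H: "H > 0" and X: "X > 0" and Y: "Y > 0"
    and A: "finite A" "\<And>x. x \<in> A \<Longrightarrow> coprime x m"
    and B: "\<And>h. h \<in> B \<Longrightarrow> h \<noteq> 0 \<and> \<bar>h\<bar> \<le> H \<and> H \<le> 2 * \<bar>h\<bar> \<and> 2 * \<bar>h\<bar> \<le> m"
    and Q: "\<And>r. real (card {(h, x). h \<in> B \<and> x \<in> A \<and> [h * x = r] (mod m)})
      \<le> Q * (of_int H * of_int X / of_int m + 1)"
  shows "(\<Sum>a = 1..m. (norm (\<Sum>h\<in>B. \<Sum>x\<in>A.
      interval_coeff m Y Z h * add_char m (a * (h * modular_inverse m x))))\<^sup>2)
    \<le> 32 * Q * real (card A) * (of_int X + of_int Y) * (of_int m)\<^sup>2"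
proof -
  define \<mu> \<eta> \<xi> \<upsilon> where "\<mu> = real_of_int m" and "\<eta> = real_of_int H" and "\<xi> = real_of_int X" and "\<upsilon> = real_of_int Y"
  have pos: "\<mu> > 0" "\<eta> > 0" "\<xi> > 0" "\<upsilon> > 0"
    using m H X Y by (simp_all add: \<mu>_def \<eta>_def \<xi>_def \<upsilon>_def)
  \<comment> \<open>Since \<open>\<bar>h\<bar> \<ge> H / 2\<close> on the block, the bound
    \<open>2 * m / \<bar>h\<bar>\<close> for the coefficient is at most
    \<open>4 * m / H\<close>.\<close>
  define W where "W = min \<upsilon> (4 * \<mu> / \<eta>)"
  have W: "W \<ge> 0" "W \<le> \<upsilon>" "W * \<eta> \<le> 4 * \<mu>"
    using pos by (auto simp: W_def min_def field_simps)
  have sub: "B \<subseteq> {-H..H} - {0}" using B by force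
  then have finB: "finite B" by (rule finite_subset) simp
  have "card B \<le> card ({-H..H} - {0})" using sub by (intro card_mono) auto
  also have "\<dots> = nat (2 * H)" using H by (simp add: card_Diff_singleton nat_diff_distrib)
  finally have cardB: "real (card B) \<le> 2 * \<eta>" using H by (simp add: \<eta>_def)
  have coeff: "norm (interval_coeff m Y Z h) \<le> W" if h: "h \<in> B" for h
  proof -
    have "norm (interval_coeff m Y Z h) \<le> 2 * \<mu> / of_int \<bar>- h\<bar>"
      unfolding interval_coeff_def \<mu>_def using B[OF h] Y m by (intro norm_add_char_sum_le) auto
    also have "\<dots> \<le> 2 * \<mu> / (\<eta> / 2)"
    proof (rule divide_left_mono)
      have "real_of_int H \<le> real_of_int (2 * \<bar>h\<bar>)" using B[OF h] by (simp only: of_int_le_iff)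
      then show "\<eta> / 2 \<le> of_int \<bar>- h\<bar>" by (simp add: \<eta>_def)
      show "0 < real_of_int \<bar>- h\<bar> * (\<eta> / 2)" using B[OF h] pos by simp
    qed (use pos in simp)
    finally have "norm (interval_coeff m Y Z h) \<le> 4 * \<mu> / \<eta>" by simp
    then show ?thesis using norm_interval_coeff_le[OF Y, of m Z h] by (simp add: W_def \<upsilon>_def)
  qed
  have "card {} \<le> card {(h, x). h \<in> B \<and> x \<in> A \<and> [h * x = 0] (mod m)}" by simp
  \<comment> \<open>A cardinality is at most \<open>Q\<close> times a positive number, so
    \<open>Q\<close> cannot be negative.\<close>
  have Q0: "Q \<ge> 0"
  proof -
    have "0 \<le> Q * (\<eta> * \<xi> / \<mu> + 1)"
      using Q[of 0] unfolding \<mu>_def \<eta>_def \<xi>_def by (meson of_nat_0_le_iff order_trans)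
    moreover have "\<eta> * \<xi> / \<mu> + 1 > 0" using pos by (simp add: add_pos_pos)
    ultimately show ?thesis by (simp add: zero_le_mult_iff)
  qed
  let ?E = "{(p, q). p \<in> B \<times> A \<and> q \<in> B \<times> A \<and>
      [fst p * modular_inverse m (snd p) = fst q * modular_inverse m (snd q)] (mod m)}"
  have "(\<Sum>a = 1..m. (norm (\<Sum>h\<in>B. \<Sum>x\<in>A.
      interval_coeff m Y Z h * add_char m (a * (h * modular_inverse m x))))\<^sup>2)
    = (\<Sum>a = 1..m. (norm (\<Sum>p\<in>B \<times> A.
      interval_coeff m Y Z (fst p) * add_char m (a * (fst p * modular_inverse m (snd p)))))\<^sup>2)"
    by (simp add: sum.cartesian_product split_def)
  also have "\<dots> \<le> \<mu> * W\<^sup>2 * real (card ?E)"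
    unfolding \<mu>_def using finB A(1) coeff by (intro sum_norm_add_char_sum_le[OF m]) auto
  also have "\<dots> \<le> \<mu> * W\<^sup>2 * (real (card B) * real (card A) * (Q * (\<eta> * \<xi> / \<mu> + 1)))"
    using pos Q unfolding \<mu>_def \<eta>_def \<xi>_def
    by (intro mult_left_mono card_cross_ratio_cong_le A finB) auto
  also have "\<dots> \<le> \<mu> * W\<^sup>2 * (2 * \<eta> * real (card A) * (Q * (\<eta> * \<xi> / \<mu> + 1)))"
    using pos Q0 cardB by (intro mult_left_mono mult_right_mono) auto
  \<comment> \<open>Regrouped so that the first term uses \<open>W * \<eta> \<le> 4 * \<mu>\<close>
    twice, and the second uses it once together with \<open>W \<le> \<upsilon>\<close>.\<close>
  also have "\<dots> = Q * real (card A) * (2 * (W * \<eta>)\<^sup>2 * \<xi> + 2 * W * (W * \<eta>) * \<mu>)"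
    using pos by (simp add: field_simps power2_eq_square)
  also have "\<dots> \<le> Q * real (card A) * (2 * (4 * \<mu>)\<^sup>2 * \<xi> + 2 * \<upsilon> * (4 * \<mu>) * \<mu>)"
  proof (intro mult_left_mono add_mono)
    show "2 * (W * \<eta>)\<^sup>2 * \<xi> \<le> 2 * (4 * \<mu>)\<^sup>2 * \<xi>"
      using pos W by (intro mult_right_mono mult_left_mono power_mono) auto
    have "2 * W * (W * \<eta>) \<le> 2 * \<upsilon> * (4 * \<mu>)"
      by (rule mult_mono) (use pos W in auto)
    then show "2 * W * (W * \<eta>) * \<mu> \<le> 2 * \<upsilon> * (4 * \<mu>) * \<mu>"
      using pos by (intro mult_right_mono) auto
  qed (use Q0 in simp)
  also have "\<dots> \<le> Q * real (card A) * (32 * (\<xi> + \<upsilon>) * \<mu>\<^sup>2)"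
    using pos Q0 by (intro mult_left_mono) (auto simp: power2_eq_square algebra_simps)
  finally show ?thesis by (simp add: \<mu>_def \<xi>_def \<upsilon>_def mult_ac)
qed

section \<open>Assembling the dyadic blocks\<close>

theorem theorem1:
  shows "\<forall>\<epsilon>::real. \<epsilon> > 0 \<longrightarrow>
    (\<exists>C::real. C > 0 \<and>
      (\<forall>(m::int) (X::int) (Y::int) (Z::int) (A::int set).
        m > 0 \<longrightarrow> X > 0 \<longrightarrow> Y > 0 \<longrightarrow> Y \<le> m \<longrightarrow> A \<subseteq> {x. \<bar>x\<bar> \<le> X} \<longrightarrow>
        (\<Sum>a = 1..m. \<bar>real (ratio_count a m A Y Z)
              - real (card (coprime_part A m)) * (of_int Y / of_int m)\<bar>\<^sup>2)
          \<le> C * real (card A) * (of_int X + of_int Y) * of_int m powr \<epsilon>))"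
proof (intro allI impI)
  fix \<epsilon> :: real assume "\<epsilon> > 0"
  \<comment> \<open>One third of the exponent pays for the divisor bound, the other two for the
    square of the number of blocks.\<close>
  define \<delta> where "\<delta> = \<epsilon> / 3"
  have \<delta>: "\<delta> > 0" using \<open>\<epsilon> > 0\<close> by (simp add: \<delta>_def)
  obtain K where K: "K \<ge> 1" "\<And>k. real k + 1 \<le> K * 2 powr (\<delta> * real k)"
    using linear_le_exponential[OF \<delta>] by metis
  obtain D where D: "D > 0" "\<And>m H X r :: int. m > 1 \<Longrightarrow> H \<ge> 1 \<Longrightarrow> H \<le> m \<Longrightarrow> X > 0 \<Longrightarrow>
      real (card {(h, x). h \<noteq> 0 \<and> \<bar>h\<bar> \<le> H \<and> coprime x m \<and> \<bar>x\<bar> \<le> X \<and> [h * x = r] (mod m)})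
      \<le> D * of_int m powr \<delta> * (of_int H * of_int X / of_int m + 1)"
    using card_mult_cong_coprime_le[OF \<delta>] by blast
  show "\<exists>C::real. C > 0 \<and>
      (\<forall>(m::int) (X::int) (Y::int) (Z::int) (A::int set).
        m > 0 \<longrightarrow> X > 0 \<longrightarrow> Y > 0 \<longrightarrow> Y \<le> m \<longrightarrow> A \<subseteq> {x. \<bar>x\<bar> \<le> X} \<longrightarrow>
        (\<Sum>a = 1..m. \<bar>real (ratio_count a m A Y Z)
              - real (card (coprime_part A m)) * (of_int Y / of_int m)\<bar>\<^sup>2)
          \<le> C * real (card A) * (of_int X + of_int Y) * of_int m powr \<epsilon>)"
  proof (intro exI[of _ "32 * D * K\<^sup>2"] conjI allI impI)
    show "32 * D * K\<^sup>2 > 0" using D(1) K(1) by simp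
    fix m X Y Z :: int and A :: "int set"
    assume m: "m > 0" and X: "X > 0" and Y: "Y > 0" "Y \<le> m" and A: "A \<subseteq> {x. \<bar>x\<bar> \<le> X}"
    have A_le: "\<bar>x\<bar> \<le> X" if "x \<in> A" for x using A that by blast
    have "finite A"
      by (rule finite_subset[of _ "{-X..X}"]) (use A_le in \<open>auto simp: abs_le_iff minus_le_iff\<close>)
    define A' where "A' = coprime_part A m"
    have A'_sub: "A' \<subseteq> A" by (auto simp: A'_def coprime_part_def)
    have A': "finite A'" "\<And>x. x \<in> A' \<Longrightarrow> coprime x m" "\<And>x. x \<in> A' \<Longrightarrow> \<bar>x\<bar> \<le> X"
      using A_le \<open>finite A\<close> by (auto simp: A'_def coprime_part_def coprime_iff_gcd_eq_1)
    have cardA': "real (card A') \<le> real (card A)"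
      using card_mono[OF \<open>finite A\<close> A'_sub] by simp
    define R where "R = {-(m div 2)..<-(m div 2) + m} - {0}"
    have R: "h \<noteq> 0" "2 * \<bar>h\<bar> \<le> m" if "h \<in> R" for h
      using that m by (auto simp: R_def)
    have finR: "finite R" by (simp add: R_def)
    define T where "T a h = (\<Sum>x\<in>A'. interval_coeff m Y Z h * add_char m (a * (h * modular_inverse m x)))" for a h
    obtain L where L: "2 ^ L \<le> nat m" "nat m < 2 ^ Suc L"
      using dyadic_exponent[of "nat m"] m by auto
    have "\<forall>h\<in>R. \<exists>j. 2 ^ j \<le> nat \<bar>h\<bar> \<and> nat \<bar>h\<bar> < 2 ^ Suc j"
    proof
      fix h assume "h \<in> R"
      then have "nat \<bar>h\<bar> > 0" using R by simp
      then show "\<exists>j. 2 ^ j \<le> nat \<bar>h\<bar> \<and> nat \<bar>h\<bar> < 2 ^ Suc j"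
        using dyadic_exponent by metis
    qed
    then obtain g where g: "\<And>h. h \<in> R \<Longrightarrow> 2 ^ g h \<le> nat \<bar>h\<bar> \<and> nat \<bar>h\<bar> < 2 ^ Suc (g h)"
      by metis
    \<comment> \<open>From \<open>2 * \<bar>h\<bar> \<le> m\<close> the exponent gains one, so the
      blocks \<open>j < L\<close> cover all frequencies. For \<open>m = 1\<close> there are no
      blocks.\<close>
    have g_less: "g h < L" if "h \<in> R" for h
    proof -
      have "2 * nat \<bar>h\<bar> \<le> nat m" using R(2)[OF that] by linarith
      moreover have "2 ^ g h \<le> nat \<bar>h\<bar>" using g[OF that] ..
      ultimately have "2 ^ Suc (g h) \<le> nat m" unfolding power_Suc by linarith
      then have "(2::nat) ^ Suc (g h) < 2 ^ Suc L" using L(2) by linarith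
      then show ?thesis by (simp add: power_strict_increasing_iff)
    qed
    define B where "B j = {h \<in> R. g h = j}" for j
    have block: "(\<Sum>a = 1..m. (norm (\<Sum>h\<in>B j. T a h))\<^sup>2)
        \<le> 32 * (D * of_int m powr \<delta>) * real (card A') * (of_int X + of_int Y) * (of_int m)\<^sup>2"
      if j: "j < L" for j
    proof -
      define H where "H = (2::int) ^ Suc j"
      have "(2::nat) ^ Suc j \<le> 2 ^ L" using j by (intro power_increasing) auto
      then have "int (2 ^ Suc j) \<le> int (nat m)" using L(1) by linarith
      then have Hm: "H \<le> m" using m by (simp add: H_def)
      \<comment> \<open>Together with \<open>H \<le> m\<close> this supplies the condition
        \<open>m > 1\<close> of the counting bound.\<close>
      have H1: "H > 1" unfolding H_def by (rule one_less_power) auto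
      have BH: "h \<noteq> 0 \<and> \<bar>h\<bar> \<le> H \<and> H \<le> 2 * \<bar>h\<bar> \<and> 2 * \<bar>h\<bar> \<le> m" if "h \<in> B j" for h
      proof -
        have h: "h \<in> R" "g h = j" using that by (auto simp: B_def)
        then have "int (2 ^ j) \<le> int (nat \<bar>h\<bar>)" "int (nat \<bar>h\<bar>) < int (2 ^ Suc j)"
          using g[OF h(1)] unfolding of_nat_le_iff of_nat_less_iff by auto
        then show ?thesis using R[OF h(1)] by (simp add: H_def)
      qed
      show ?thesis
        unfolding T_def
      proof (rule dyadic_block_second_moment[where H = H])
        fix r
        let ?S = "{(h, x). h \<noteq> 0 \<and> \<bar>h\<bar> \<le> H \<and> coprime x m \<and> \<bar>x\<bar> \<le> X \<and> [h * x = r] (mod m)}"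
        have "finite ?S" by (rule finite_subset[of _ "{-H..H} \<times> {-X..X}"]) auto
        then have "card {(h, x). h \<in> B j \<and> x \<in> A' \<and> [h * x = r] (mod m)} \<le> card ?S"
          by (rule card_mono) (use BH A' in auto)
        then have "real (card {(h, x). h \<in> B j \<and> x \<in> A' \<and> [h * x = r] (mod m)}) \<le> real (card ?S)"
          by (rule of_nat_mono)
        also have "\<dots> \<le> D * of_int m powr \<delta> * (of_int H * of_int X / of_int m + 1)"
          using H1 Hm X by (intro D(2)) auto
        finally show "real (card {(h, x). h \<in> B j \<and> x \<in> A' \<and> [h * x = r] (mod m)})
          \<le> D * of_int m powr \<delta> * (of_int H * of_int X / of_int m + 1)" .
      qed (use m H1 X Y A' BH in auto)
    qed
    \<comment> \<open>Cauchy-Schwarz over the \<open>L\<close> blocks costs one factor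
      \<open>L\<close>; the denominator is the square of the Fourier normalisation.\<close>
    have pointwise: "\<bar>real (ratio_count a m A Y Z) - real (card (coprime_part A m)) * (of_int Y / of_int m)\<bar>\<^sup>2
        \<le> (\<Sum>j<L. (norm (\<Sum>h\<in>B j. T a h))\<^sup>2) * real L / (of_int m)\<^sup>2" for a
    proof -
      define d where "d = real (ratio_count a m A Y Z) - real (card (coprime_part A m)) * (of_int Y / of_int m)"
      have "complex_of_real d = (\<Sum>h\<in>R. T a h) / of_int m"
        unfolding d_def T_def R_def A'_def by (rule ratio_count_fourier[OF m Y \<open>finite A\<close>])
      also have "(\<Sum>h\<in>R. T a h) = (\<Sum>j<L. \<Sum>h\<in>B j. T a h)"
        unfolding B_def using finR g_less by (intro sum.group[symmetric]) auto
      finally have "norm (complex_of_real d) = norm (\<Sum>j<L. \<Sum>h\<in>B j. T a h) / of_int m"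
        using m by (simp add: norm_divide)
      also have "\<dots> \<le> (\<Sum>j<L. norm (\<Sum>h\<in>B j. T a h)) / of_int m"
        using m by (intro divide_right_mono norm_sum) auto
      finally have "\<bar>d\<bar> \<le> (\<Sum>j<L. norm (\<Sum>h\<in>B j. T a h)) / of_int m" by simp
      then have "\<bar>d\<bar>\<^sup>2 \<le> ((\<Sum>j<L. norm (\<Sum>h\<in>B j. T a h)) / of_int m)\<^sup>2"
        by (intro power_mono) auto
      also have "\<dots> = (\<Sum>j<L. norm (\<Sum>h\<in>B j. T a h))\<^sup>2 / (of_int m)\<^sup>2"
        by (rule power_divide)
      also have "\<dots> \<le> (\<Sum>j<L. (norm (\<Sum>h\<in>B j. T a h))\<^sup>2) * real L / (of_int m)\<^sup>2"
        using sum_squared_le_sum_of_squares[of "\<lambda>j. norm (\<Sum>h\<in>B j. T a h)" "{..<L}"]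
        by (intro divide_right_mono) auto
      finally show ?thesis by (simp only: d_def)
    qed
    have L_le: "real L \<le> K * of_int m powr \<delta>"
    proof -
      have "real (2 ^ L) \<le> real (nat m)" using L(1) by (rule of_nat_mono)
      then have "2 powr real L \<le> of_int m" using m by (simp add: powr_realpow)
      then have "(2 powr real L) powr \<delta> \<le> of_int m powr \<delta>"
        using \<delta> by (intro powr_mono2) auto
      then have "2 powr (\<delta> * real L) \<le> of_int m powr \<delta>"
        by (simp add: powr_powr mult.commute)
      then have "K * 2 powr (\<delta> * real L) \<le> K * of_int m powr \<delta>"
        using K(1) by (intro mult_left_mono) auto
      then show ?thesis using K(2)[of L] by linarith
    qed
    define P where "P = 32 * (D * of_int m powr \<delta>) * real (card A') * (of_int X + of_int Y)"
    have P: "P \<ge> 0" using D(1) X Y by (simp add: P_def)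
    have "(\<Sum>a = 1..m. \<bar>real (ratio_count a m A Y Z) - real (card (coprime_part A m)) * (of_int Y / of_int m)\<bar>\<^sup>2)
        \<le> (\<Sum>a = 1..m. (\<Sum>j<L. (norm (\<Sum>h\<in>B j. T a h))\<^sup>2) * real L / (of_int m)\<^sup>2)"
      by (intro sum_mono pointwise)
    also have "\<dots> = (\<Sum>j<L. \<Sum>a = 1..m. (norm (\<Sum>h\<in>B j. T a h))\<^sup>2) * real L / (of_int m)\<^sup>2"
      unfolding sum_divide_distrib[symmetric] sum_distrib_right[symmetric] by (subst sum.swap) simp
    \<comment> \<open>The factor \<open>m\<^sup>2\<close> of the block bound cancels the
      normalisation; summing the \<open>L\<close> equal bounds gives the second factor
      \<open>L\<close>.\<close>
    also have "\<dots> \<le> (\<Sum>j<L. P * (of_int m)\<^sup>2) * real L / (of_int m)\<^sup>2"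
      using block unfolding P_def by (intro divide_right_mono mult_right_mono sum_mono) auto
    also have "\<dots> = P * (real L)\<^sup>2"
      using m by (simp add: power2_eq_square)
    also have "\<dots> \<le> P * (K * of_int m powr \<delta>)\<^sup>2"
      using P L_le by (intro mult_left_mono power_mono) auto
    also have "\<dots> = 32 * D * K\<^sup>2 * real (card A') * (of_int X + of_int Y) * (of_int m powr \<delta> * of_int m powr \<delta> * of_int m powr \<delta>)"
      by (simp add: P_def power2_eq_square mult_ac)
    also have "of_int m powr \<delta> * of_int m powr \<delta> * of_int m powr \<delta> = of_int m powr \<epsilon>"
      by (simp add: powr_add[symmetric] \<delta>_def)
    also have "32 * D * K\<^sup>2 * real (card A') * (of_int X + of_int Y) * of_int m powr \<epsilon>
        \<le> 32 * D * K\<^sup>2 * real (card A) * (of_int X + of_int Y) * of_int m powr \<epsilon>"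
      using cardA' D(1) X Y by (intro mult_right_mono mult_left_mono) auto
    finally show "(\<Sum>a = 1..m. \<bar>real (ratio_count a m A Y Z) - real (card (coprime_part A m)) * (of_int Y / of_int m)\<bar>\<^sup>2)
        \<le> 32 * D * K\<^sup>2 * real (card A) * (of_int X + of_int Y) * of_int m powr \<epsilon>" .
  qed
qed

end
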